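(* Let $E$ be a $k$-vector space, let $C_1,C_2\subseteq E$ be subspaces such that $(C_1,\Delta_1,\epsilon_1)$ and $(C_2,\Delta_2,\epsilon_2)$ are coassociative counital coalgebras, let $\Phi:C_1\to C_2$ be a channel map, and put $\mathbb{D}:=C_1+C_2\subseteq E$. Let $\Delta_*,\delta_1,\hat\delta_1:\mathbb{D}\to\mathbb{D}^{\otimes 2}$ be linear maps such that - $\Delta_*=\Delta_1$ on $C_1$ and $\Delta_*=\Delta_2$ on $C_2$; - $\delta_1=\Delta_1$ on $C_1$ and $\delta_1\Phi=(id\otimes\Phi)\Delta_1$; - $\hat\delta_1=\Delta_1$ on $C_1$ and $\hat\delta_1\Phi=(\Phi\otimes id)\Delta_1$. Then $(\mathbb{D},\delta_1,\hat\delta_1)$ is a coassociative codialgebra and $(\mathbb{D},\Delta_*,\delta_1,\hat\delta_1)$ is a coassociative cotrialgebra.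
   Context: $k$ is $\mathbb{R}$ or $\mathbb{C}$; all vector spaces have finite or countable dimension. Channel map: an invertible linear map $\Phi:C_1\to C_2$ that is a coalgebra morphism: $\Delta_2\Phi=(\Phi\otimes\Phi)\Delta_1$ and $\epsilon_2\Phi=\epsilon_1$. Coassociative codialgebra $(D,\delta,\hat\delta)$: a vector space with linear maps $\delta,\hat\delta:D\to D^{\otimes2}$ such that $\delta$ and $\hat\delta$ are coassociative and $(id\otimes\hat\delta)\hat\delta=(id\otimes\delta)\hat\delta$, $(\delta\otimes id)\delta=(\hat\delta\otimes id)\delta$, $(\delta\otimes id)\hat\delta=(id\otimes\hat\delta)\delta$. Coassociative cotrialgebra $(T,\Delta,\delta,\hat\delta)$: a vector space with three linear maps $T\to T^{\otimes2}$ such that $\Delta$ is coassociative, $(T,\delta,\hat\delta)$ is a coassociative codialgebra, and $(\hat\delta\otimes id)\hat\delta=(id\otimes\Delta)\hat\delta$, $(\Delta\otimes id)\hat\delta=(id\otimes\hat\delta)\Delta$, $(\hat\delta\otimes id)\Delta=(id\otimes\delta)\Delta$, $(\delta\otimes id)\Delta=(id\otimes\Delta)\delta$, $(\Delta\otimes id)\delta=(id\otimes\delta)\delta$. The maps prescribed separately on $C_1$ and on $C_2$ are assumed to exist as linear maps on $C_1+C_2$ (automatic when $C_1\cap C_2=0$). *)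

theory Defs
  imports
    Complex_Main
    "HOL-Library.Countable_Set"
    "HOL-Library.Function_Algebras"
    "HOL-Library.Set_Algebras"
begin

section \<open>Ground field, dimension, linear maps between subspaces\<close>

definition real_or_complex_field :: "'k::field itself \<Rightarrow> bool" where
  "real_or_complex_field _ \<longleftrightarrow>
     (\<exists>f :: 'k \<Rightarrow> real. bij f \<and> (\<forall>x y. f (x + y) = f x + f y \<and> f (x * y) = f x * f y)) \<or>
     (\<exists>f :: 'k \<Rightarrow> complex. bij f \<and> (\<forall>x y. f (x + y) = f x + f y \<and> f (x * y) = f x * f y))"

text \<open>\<^const>\<open>countable\<close> includes the finite case.\<close>

definition countable_dimension :: "('k::field \<Rightarrow> 'v::ab_group_add \<Rightarrow> 'v) \<Rightarrow> bool" where
  "countable_dimension s \<longleftrightarrow>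
     (\<exists>B. countable B \<and> \<not> module.dependent s B \<and> module.span s B = UNIV)"

text \<open>The library's \<^const>\<open>Vector_Spaces.linear\<close> only speaks about maps on a whole type; here \<open>f\<close> is
  a linear map from the subspace \<open>A\<close> to the subspace \<open>B\<close>, with irrelevant values outside \<open>A\<close>.\<close>

definition linear_map_on ::
  "('k::field \<Rightarrow> 'v::ab_group_add \<Rightarrow> 'v) \<Rightarrow> ('k \<Rightarrow> 'w::ab_group_add \<Rightarrow> 'w) \<Rightarrow> 'v set \<Rightarrow> 'w set
     \<Rightarrow> ('v \<Rightarrow> 'w) \<Rightarrow> bool" where
  "linear_map_on s1 s2 A B f \<longleftrightarrow>
     f ` A \<subseteq> B \<and>
     (\<forall>x\<in>A. \<forall>y\<in>A. f (x + y) = f x + f y) \<and>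
     (\<forall>c. \<forall>x\<in>A. f (s1 c x) = s2 c (f x))"


section \<open>Algebraic tensor products of vector spaces\<close>

text \<open>\<open>V \<otimes> W\<close> is realised as the span of the evaluations \<open>v \<otimes> w : \<beta> \<mapsto> \<beta>(v,w)\<close> inside the dual of
  the space of bilinear forms on \<open>V \<times> W\<close>, as in Ryan, \<^emph>\<open>Introduction to Tensor Products of Banach
  Spaces\<close>, Section 1.1. Functionals are extended by \<open>0\<close> to functions \<open>\<beta>\<close> that are not bilinear forms.
  This is a tensor product: see \<open>tensor_lift_linear\<close>, \<open>tensor_lift_tensor\<close>, \<open>tensor_unique\<close> below
  for the universal property with respect to bilinear maps into arbitrary vector spaces.

  The tensor product \<open>A \<otimes> B\<close> of subspaces \<open>A \<subseteq> V\<close>, \<open>B \<subseteq> W\<close> is identified, as usual, with the span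
  of the \<open>a \<otimes> b\<close> in \<open>V \<otimes> W\<close>.\<close>

definition fscale :: "'k::field \<Rightarrow> ('a \<Rightarrow> 'k) \<Rightarrow> ('a \<Rightarrow> 'k)" where
  "fscale c t = (\<lambda>x. c * t x)"

definition bilinear_form ::
  "('k::field \<Rightarrow> 'v::ab_group_add \<Rightarrow> 'v) \<Rightarrow> ('k \<Rightarrow> 'w::ab_group_add \<Rightarrow> 'w) \<Rightarrow> ('v \<Rightarrow> 'w \<Rightarrow> 'k) \<Rightarrow> bool" where
  "bilinear_form s1 s2 \<beta> \<longleftrightarrow>
     (\<forall>w. Vector_Spaces.linear s1 (*) (\<lambda>v. \<beta> v w)) \<and> (\<forall>v. Vector_Spaces.linear s2 (*) (\<beta> v))"

definition tensor ::
  "('k::field \<Rightarrow> 'v::ab_group_add \<Rightarrow> 'v) \<Rightarrow> ('k \<Rightarrow> 'w::ab_group_add \<Rightarrow> 'w) \<Rightarrow> 'v \<Rightarrow> 'w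
     \<Rightarrow> ('v \<Rightarrow> 'w \<Rightarrow> 'k) \<Rightarrow> 'k" where
  "tensor s1 s2 v w = (\<lambda>\<beta>. if bilinear_form s1 s2 \<beta> then \<beta> v w else 0)"

definition tensor_space ::
  "('k::field \<Rightarrow> 'v::ab_group_add \<Rightarrow> 'v) \<Rightarrow> ('k \<Rightarrow> 'w::ab_group_add \<Rightarrow> 'w) \<Rightarrow> 'v set \<Rightarrow> 'w set
     \<Rightarrow> (('v \<Rightarrow> 'w \<Rightarrow> 'k) \<Rightarrow> 'k) set" where
  "tensor_space s1 s2 A B = module.span fscale {tensor s1 s2 a b | a b. a \<in> A \<and> b \<in> B}"

text \<open>The linear map \<open>A \<otimes> B \<rightarrow> U\<close> with \<open>a \<otimes> b \<mapsto> f a b\<close>, for \<open>f\<close> bilinear on \<open>A \<times> B\<close>.\<close>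

definition tensor_lift ::
  "('k::field \<Rightarrow> 'v::ab_group_add \<Rightarrow> 'v) \<Rightarrow> ('k \<Rightarrow> 'w::ab_group_add \<Rightarrow> 'w) \<Rightarrow> 'v set \<Rightarrow> 'w set
     \<Rightarrow> ('v \<Rightarrow> 'w \<Rightarrow> 'u::ab_group_add) \<Rightarrow> (('v \<Rightarrow> 'w \<Rightarrow> 'k) \<Rightarrow> 'k) \<Rightarrow> 'u" where
  "tensor_lift s1 s2 A B f t =
     (THE u. \<exists>xs. set xs \<subseteq> A \<times> B \<and> t = (\<Sum>(a, b)\<leftarrow>xs. tensor s1 s2 a b) \<and> u = (\<Sum>(a, b)\<leftarrow>xs. f a b))"

text \<open>\<open>f \<otimes> g\<close> on \<open>A \<otimes> B\<close>, where \<open>f\<close> is linear on \<open>A\<close> (from scalars \<open>s1\<close> to \<open>t1\<close>) and \<open>g\<close> is linear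
  on \<open>B\<close> (from scalars \<open>s2\<close> to \<open>t2\<close>).\<close>

definition tensor_map ::
  "('k::field \<Rightarrow> 'v::ab_group_add \<Rightarrow> 'v) \<Rightarrow> ('k \<Rightarrow> 'w::ab_group_add \<Rightarrow> 'w)
     \<Rightarrow> ('k \<Rightarrow> 'x::ab_group_add \<Rightarrow> 'x) \<Rightarrow> ('k \<Rightarrow> 'y::ab_group_add \<Rightarrow> 'y)
     \<Rightarrow> 'v set \<Rightarrow> 'w set \<Rightarrow> ('v \<Rightarrow> 'x) \<Rightarrow> ('w \<Rightarrow> 'y)
     \<Rightarrow> (('v \<Rightarrow> 'w \<Rightarrow> 'k) \<Rightarrow> 'k) \<Rightarrow> (('x \<Rightarrow> 'y \<Rightarrow> 'k) \<Rightarrow> 'k)" where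
  "tensor_map s1 s2 t1 t2 A B f g = tensor_lift s1 s2 A B (\<lambda>a b. tensor t1 t2 (f a) (g b))"

text \<open>The canonical isomorphism \<open>(D \<otimes> D) \<otimes> D \<rightarrow> D \<otimes> (D \<otimes> D)\<close>.\<close>

definition tensor_assoc ::
  "('k::field \<Rightarrow> 'v::ab_group_add \<Rightarrow> 'v) \<Rightarrow> 'v set
     \<Rightarrow> (((('v \<Rightarrow> 'v \<Rightarrow> 'k) \<Rightarrow> 'k) \<Rightarrow> 'v \<Rightarrow> 'k) \<Rightarrow> 'k)
     \<Rightarrow> (('v \<Rightarrow> (('v \<Rightarrow> 'v \<Rightarrow> 'k) \<Rightarrow> 'k) \<Rightarrow> 'k) \<Rightarrow> 'k)" where
  "tensor_assoc s D =
     tensor_lift fscale s (tensor_space s s D D) D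
       (\<lambda>t c. tensor_lift s s D D (\<lambda>a b. tensor s fscale a (tensor s s b c)) t)"


section \<open>Coalgebras, codialgebras, cotrialgebras\<close>

text \<open>For \<open>f : D \<rightarrow> D \<otimes> D\<close> these are \<open>f \<otimes> id\<close>, followed by the identification of \<open>(D \<otimes> D) \<otimes> D\<close> with
  \<open>D \<otimes> (D \<otimes> D)\<close>, and \<open>id \<otimes> f\<close>.\<close>

definition tensor_id_right ::
  "('k::field \<Rightarrow> 'v::ab_group_add \<Rightarrow> 'v) \<Rightarrow> 'v set \<Rightarrow> ('v \<Rightarrow> (('v \<Rightarrow> 'v \<Rightarrow> 'k) \<Rightarrow> 'k))
     \<Rightarrow> (('v \<Rightarrow> 'v \<Rightarrow> 'k) \<Rightarrow> 'k) \<Rightarrow> (('v \<Rightarrow> (('v \<Rightarrow> 'v \<Rightarrow> 'k) \<Rightarrow> 'k) \<Rightarrow> 'k) \<Rightarrow> 'k)" where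
  "tensor_id_right s D f t = tensor_assoc s D (tensor_map s s fscale s D D f id t)"

definition tensor_id_left ::
  "('k::field \<Rightarrow> 'v::ab_group_add \<Rightarrow> 'v) \<Rightarrow> 'v set \<Rightarrow> ('v \<Rightarrow> (('v \<Rightarrow> 'v \<Rightarrow> 'k) \<Rightarrow> 'k))
     \<Rightarrow> (('v \<Rightarrow> 'v \<Rightarrow> 'k) \<Rightarrow> 'k) \<Rightarrow> (('v \<Rightarrow> (('v \<Rightarrow> 'v \<Rightarrow> 'k) \<Rightarrow> 'k) \<Rightarrow> 'k) \<Rightarrow> 'k)" where
  "tensor_id_left s D f t = tensor_map s s s fscale D D id f t"

definition coassociative ::
  "('k::field \<Rightarrow> 'v::ab_group_add \<Rightarrow> 'v) \<Rightarrow> 'v set \<Rightarrow> ('v \<Rightarrow> (('v \<Rightarrow> 'v \<Rightarrow> 'k) \<Rightarrow> 'k)) \<Rightarrow> bool" where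
  "coassociative s D \<Delta> \<longleftrightarrow>
     (\<forall>x\<in>D. tensor_id_right s D \<Delta> (\<Delta> x) = tensor_id_left s D \<Delta> (\<Delta> x))"

text \<open>Counitality is written \<open>(\<epsilon> \<otimes> id) (\<Delta> x) = 1 \<otimes> x\<close> in \<open>k \<otimes> C\<close> and
  \<open>(id \<otimes> \<epsilon>) (\<Delta> x) = x \<otimes> 1\<close> in \<open>C \<otimes> k\<close>.\<close>

definition counital_coalgebra ::
  "('k::field \<Rightarrow> 'v::ab_group_add \<Rightarrow> 'v) \<Rightarrow> 'v set \<Rightarrow> ('v \<Rightarrow> (('v \<Rightarrow> 'v \<Rightarrow> 'k) \<Rightarrow> 'k))
     \<Rightarrow> ('v \<Rightarrow> 'k) \<Rightarrow> bool" where
  "counital_coalgebra s C \<Delta> \<epsilon> \<longleftrightarrow>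
     module.subspace s C \<and>
     linear_map_on s fscale C (tensor_space s s C C) \<Delta> \<and>
     linear_map_on s (*) C UNIV \<epsilon> \<and>
     coassociative s C \<Delta> \<and>
     (\<forall>x\<in>C. tensor_map s s (*) s C C \<epsilon> id (\<Delta> x) = tensor (*) s 1 x) \<and>
     (\<forall>x\<in>C. tensor_map s s s (*) C C id \<epsilon> (\<Delta> x) = tensor s (*) x 1)"

definition channel_map ::
  "('k::field \<Rightarrow> 'v::ab_group_add \<Rightarrow> 'v)
     \<Rightarrow> 'v set \<Rightarrow> ('v \<Rightarrow> (('v \<Rightarrow> 'v \<Rightarrow> 'k) \<Rightarrow> 'k)) \<Rightarrow> ('v \<Rightarrow> 'k)
     \<Rightarrow> 'v set \<Rightarrow> ('v \<Rightarrow> (('v \<Rightarrow> 'v \<Rightarrow> 'k) \<Rightarrow> 'k)) \<Rightarrow> ('v \<Rightarrow> 'k) \<Rightarrow> ('v \<Rightarrow> 'v) \<Rightarrow> bool" where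
  "channel_map s C1 \<Delta>1 \<epsilon>1 C2 \<Delta>2 \<epsilon>2 \<Phi> \<longleftrightarrow>
     linear_map_on s s C1 C2 \<Phi> \<and>
     bij_betw \<Phi> C1 C2 \<and>
     (\<forall>x\<in>C1. \<Delta>2 (\<Phi> x) = tensor_map s s s s C1 C1 \<Phi> \<Phi> (\<Delta>1 x)) \<and>
     (\<forall>x\<in>C1. \<epsilon>2 (\<Phi> x) = \<epsilon>1 x)"

text \<open>In the next two definitions \<open>\<delta>h\<close> stands for the second comultiplication, \<open>\<delta>\<close> with a hat.\<close>

definition coassociative_codialgebra ::
  "('k::field \<Rightarrow> 'v::ab_group_add \<Rightarrow> 'v) \<Rightarrow> 'v set \<Rightarrow> ('v \<Rightarrow> (('v \<Rightarrow> 'v \<Rightarrow> 'k) \<Rightarrow> 'k))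
     \<Rightarrow> ('v \<Rightarrow> (('v \<Rightarrow> 'v \<Rightarrow> 'k) \<Rightarrow> 'k)) \<Rightarrow> bool" where
  "coassociative_codialgebra s D \<delta> \<delta>h \<longleftrightarrow>
     module.subspace s D \<and>
     linear_map_on s fscale D (tensor_space s s D D) \<delta> \<and>
     linear_map_on s fscale D (tensor_space s s D D) \<delta>h \<and>
     coassociative s D \<delta> \<and>
     coassociative s D \<delta>h \<and>
     (\<forall>x\<in>D. tensor_id_left s D \<delta>h (\<delta>h x) = tensor_id_left s D \<delta> (\<delta>h x)) \<and>
     (\<forall>x\<in>D. tensor_id_right s D \<delta> (\<delta> x) = tensor_id_right s D \<delta>h (\<delta> x)) \<and>
     (\<forall>x\<in>D. tensor_id_right s D \<delta> (\<delta>h x) = tensor_id_left s D \<delta>h (\<delta> x))"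

definition coassociative_cotrialgebra ::
  "('k::field \<Rightarrow> 'v::ab_group_add \<Rightarrow> 'v) \<Rightarrow> 'v set \<Rightarrow> ('v \<Rightarrow> (('v \<Rightarrow> 'v \<Rightarrow> 'k) \<Rightarrow> 'k))
     \<Rightarrow> ('v \<Rightarrow> (('v \<Rightarrow> 'v \<Rightarrow> 'k) \<Rightarrow> 'k)) \<Rightarrow> ('v \<Rightarrow> (('v \<Rightarrow> 'v \<Rightarrow> 'k) \<Rightarrow> 'k)) \<Rightarrow> bool" where
  "coassociative_cotrialgebra s T \<Delta> \<delta> \<delta>h \<longleftrightarrow>
     linear_map_on s fscale T (tensor_space s s T T) \<Delta> \<and>
     coassociative s T \<Delta> \<and>
     coassociative_codialgebra s T \<delta> \<delta>h \<and>
     (\<forall>x\<in>T. tensor_id_right s T \<delta>h (\<delta>h x) = tensor_id_left s T \<Delta> (\<delta>h x)) \<and>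
     (\<forall>x\<in>T. tensor_id_right s T \<Delta> (\<delta>h x) = tensor_id_left s T \<delta>h (\<Delta> x)) \<and>
     (\<forall>x\<in>T. tensor_id_right s T \<delta>h (\<Delta> x) = tensor_id_left s T \<delta> (\<Delta> x)) \<and>
     (\<forall>x\<in>T. tensor_id_right s T \<delta> (\<Delta> x) = tensor_id_left s T \<Delta> (\<delta> x)) \<and>
     (\<forall>x\<in>T. tensor_id_right s T \<Delta> (\<delta> x) = tensor_id_left s T \<delta> (\<delta> x))"


section \<open>The universal property\<close>

lemma vector_space_fscale: "vector_space (fscale :: 'k::field \<Rightarrow> ('a \<Rightarrow> 'k) \<Rightarrow> _)"
  by unfold_locales (auto simp: fscale_def fun_eq_iff algebra_simps)

lemma vector_space_times: "vector_space ((*) :: 'k::field \<Rightarrow> 'k \<Rightarrow> 'k)"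
  by unfold_locales (auto simp: algebra_simps)

lemma linear_map_iff:
  "Vector_Spaces.linear s1 s2 f \<longleftrightarrow> vector_space s1 \<and> vector_space s2 \<and>
     (\<forall>x y. f (x + y) = f x + f y) \<and> (\<forall>c x. f (s1 c x) = s2 c (f x))"
  by (auto simp: Vector_Spaces.linear_def module_hom_def module_hom_axioms_def module_iff_vector_space)

definition bilinear_on where
  "bilinear_on s1 s2 s3 A B f \<longleftrightarrow>
     (\<forall>b\<in>B. linear_map_on s1 s3 A UNIV (\<lambda>a. f a b)) \<and> (\<forall>a\<in>A. linear_map_on s2 s3 B UNIV (f a))"

lemma bilinear_on_tensor:
  assumes "vector_space s1" "vector_space s2"
  shows "bilinear_on s1 s2 fscale A B (tensor s1 s2)"
  unfolding bilinear_on_def linear_map_on_def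
  by (auto simp: tensor_def fscale_def fun_eq_iff bilinear_form_def linear_map_iff)

lemma tensor_simps:
  assumes "vector_space s1" "vector_space s2"
  shows "tensor s1 s2 (a + a') b = tensor s1 s2 a b + tensor s1 s2 a' b"
    and "tensor s1 s2 a (b + b') = tensor s1 s2 a b + tensor s1 s2 a b'"
    and "tensor s1 s2 (s1 c a) b = fscale c (tensor s1 s2 a b)"
    and "tensor s1 s2 a (s2 c b) = fscale c (tensor s1 s2 a b)"
  using bilinear_on_tensor[OF assms, of UNIV UNIV] by (auto simp: bilinear_on_def linear_map_on_def)

lemma projection_on_subspace:
  assumes "vector_space s" and A: "module.subspace s A"
  shows "\<exists>p. Vector_Spaces.linear s s p \<and> range p \<subseteq> A \<and> (\<forall>x\<in>A. p x = x)"
proof -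
  interpret vector_space s by fact
  interpret vector_space_pair s s by unfold_locales
  have "Vector_Spaces.linear s s (\<lambda>x. x)"
    by (simp add: linear_map_iff vector_space_axioms)
  from linear_exists_left_inverse_on[OF this A] show ?thesis by (auto simp: inj_on_def)
qed

lemma functional_separates:
  assumes "vector_space s" and "u \<noteq> 0"
  shows "\<exists>\<phi>. Vector_Spaces.linear s (*) \<phi> \<and> \<phi> u = 1"
proof -
  interpret vector_space s by fact
  interpret K: vector_space "(*) :: 'a \<Rightarrow> 'a \<Rightarrow> 'a" by (rule vector_space_times)
  interpret vector_space_pair s "(*) :: 'a \<Rightarrow> 'a \<Rightarrow> 'a" by unfold_locales
  have "\<not> dependent {u}" using assms(2) by simp
  from linear_independent_extend[OF this, of "\<lambda>_. 1"] show ?thesis by auto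
qed

lemma linear_sum_list:
  assumes "Vector_Spaces.linear s t \<phi>"
  shows "\<phi> (\<Sum>(a, b)\<leftarrow>xs. f a b) = (\<Sum>(a, b)\<leftarrow>xs. \<phi> (f a b))"
proof -
  have add: "\<phi> (x + y) = \<phi> x + \<phi> y" for x y using assms unfolding linear_map_iff by blast
  have "\<phi> 0 = 0" using add[of 0 0] by simp
  then show ?thesis by (induction xs) (auto simp: add)
qed

lemma sum_list_fun_apply:
  "(\<Sum>(a, b)\<leftarrow>xs. f a b) \<beta> = (\<Sum>(a, b)\<leftarrow>xs. f a b \<beta>)"
  by (induction xs) auto

lemma tensor_lift_well_defined:
  assumes vs: "vector_space s1" "vector_space s2" "vector_space s3"
    and sub: "module.subspace s1 A" "module.subspace s2 B"
    and f: "bilinear_on s1 s2 s3 A B f"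
    and xs: "set xs \<subseteq> A \<times> B" and ys: "set ys \<subseteq> A \<times> B"
    and eq: "(\<Sum>(a, b)\<leftarrow>xs. tensor s1 s2 a b) = (\<Sum>(a, b)\<leftarrow>ys. tensor s1 s2 a b)"
  shows "(\<Sum>(a, b)\<leftarrow>xs. f a b) = (\<Sum>(a, b)\<leftarrow>ys. f a b)"
proof (rule ccontr)
  assume ne: "\<not> ?thesis"
  obtain p where p: "Vector_Spaces.linear s1 s1 p" "range p \<subseteq> A" "\<forall>x\<in>A. p x = x"
    using projection_on_subspace[OF vs(1) sub(1)] by blast
  obtain q where q: "Vector_Spaces.linear s2 s2 q" "range q \<subseteq> B" "\<forall>x\<in>B. q x = x"
    using projection_on_subspace[OF vs(2) sub(2)] by blast
  obtain \<phi> where \<phi>: "Vector_Spaces.linear s3 (*) \<phi>"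
      "\<phi> ((\<Sum>(a, b)\<leftarrow>xs. f a b) - (\<Sum>(a, b)\<leftarrow>ys. f a b)) = 1"
    using functional_separates[OF vs(3), of "(\<Sum>(a, b)\<leftarrow>xs. f a b) - (\<Sum>(a, b)\<leftarrow>ys. f a b)"] ne by auto
  define \<beta> where "\<beta> a b = \<phi> (f (p a) (q b))" for a b
  have pA: "p x \<in> A" and qB: "q y \<in> B" for x y using p q by auto
  have \<beta>: "bilinear_form s1 s2 \<beta>"
  proof -
    have lin: "p (x + y) = p x + p y" "p (s1 c x) = s1 c (p x)"
      "q (x' + y') = q x' + q y'" "q (s2 c x') = s2 c (q x')"
      "\<phi> (x'' + y'') = \<phi> x'' + \<phi> y''" "\<phi> (s3 c x'') = c * \<phi> x''" for x y x' y' x'' y'' c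
      using p(1) q(1) \<phi>(1) by (simp_all add: linear_map_iff)
    have bil: "f (p x + p y) (q z) = f (p x) (q z) + f (p y) (q z)"
      "f (s1 c (p x)) (q z) = s3 c (f (p x) (q z))"
      "f (p x) (q z + q z') = f (p x) (q z) + f (p x) (q z')"
      "f (p x) (s2 c (q z)) = s3 c (f (p x) (q z))" for x y z z' c
      using f pA qB by (simp_all add: bilinear_on_def linear_map_on_def)
    show ?thesis
      unfolding bilinear_form_def linear_map_iff \<beta>_def
      using vs vector_space_times by (simp only: lin bil) simp
  qed
  have ev: "(\<Sum>(a, b)\<leftarrow>zs. tensor s1 s2 a b) \<beta> = \<phi> (\<Sum>(a, b)\<leftarrow>zs. f a b)"
    if "set zs \<subseteq> A \<times> B" for zs
  proof -
    have "(\<Sum>(a, b)\<leftarrow>zs. tensor s1 s2 a b \<beta>) = (\<Sum>(a, b)\<leftarrow>zs. \<phi> (f a b))"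
      using that p(3) q(3) \<beta> by (intro arg_cong[where f=sum_list] map_cong) (auto simp: tensor_def \<beta>_def)
    then show ?thesis by (simp add: sum_list_fun_apply linear_sum_list[OF \<phi>(1)])
  qed
  have "\<phi> (\<Sum>(a, b)\<leftarrow>xs. f a b) = \<phi> (\<Sum>(a, b)\<leftarrow>ys. f a b)"
    using ev[OF xs] ev[OF ys] eq by simp
  moreover have "\<phi> (x - y) = \<phi> x - \<phi> y" for x y
  proof -
    have "\<phi> ((x - y) + y) = \<phi> (x - y) + \<phi> y" using \<phi>(1) unfolding linear_map_iff by blast
    then show ?thesis by simp
  qed
  ultimately show False using \<phi>(2) by simp
qed

lemma tensor_lift_eq:
  assumes "vector_space s1" "vector_space s2" "vector_space s3"
    and "module.subspace s1 A" "module.subspace s2 B"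
    and "bilinear_on s1 s2 s3 A B f" and "set xs \<subseteq> A \<times> B"
  shows "tensor_lift s1 s2 A B f (\<Sum>(a, b)\<leftarrow>xs. tensor s1 s2 a b) = (\<Sum>(a, b)\<leftarrow>xs. f a b)"
  unfolding tensor_lift_def
proof (rule the_equality)
  show "\<exists>ys. set ys \<subseteq> A \<times> B \<and> (\<Sum>(a, b)\<leftarrow>xs. tensor s1 s2 a b) = (\<Sum>(a, b)\<leftarrow>ys. tensor s1 s2 a b) \<and>
      (\<Sum>(a, b)\<leftarrow>xs. f a b) = (\<Sum>(a, b)\<leftarrow>ys. f a b)"
    using assms(7) by (intro exI[of _ xs]) simp
next
  fix u
  assume "\<exists>ys. set ys \<subseteq> A \<times> B \<and> (\<Sum>(a, b)\<leftarrow>xs. tensor s1 s2 a b) = (\<Sum>(a, b)\<leftarrow>ys. tensor s1 s2 a b) \<and>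
      u = (\<Sum>(a, b)\<leftarrow>ys. f a b)"
  then obtain ys where ys: "set ys \<subseteq> A \<times> B"
      "(\<Sum>(a, b)\<leftarrow>xs. tensor s1 s2 a b) = (\<Sum>(a, b)\<leftarrow>ys. tensor s1 s2 a b)"
      "u = (\<Sum>(a, b)\<leftarrow>ys. f a b)" by (elim exE conjE) rule
  show "u = (\<Sum>(a, b)\<leftarrow>xs. f a b)"
    unfolding ys(3) by (rule tensor_lift_well_defined[OF assms(1-6) ys(1) assms(7) ys(2)[symmetric]])
qed

lemma tensor_lift_tensor:
  assumes "vector_space s1" "vector_space s2" "vector_space s3"
    and "module.subspace s1 A" "module.subspace s2 B"
    and "bilinear_on s1 s2 s3 A B f" and "a \<in> A" "b \<in> B"
  shows "tensor_lift s1 s2 A B f (tensor s1 s2 a b) = f a b"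
  using tensor_lift_eq[OF assms(1-6), of "[(a, b)]"] assms(7-8) by simp

lemma scale_sum_list_tensor:
  assumes vs: "vector_space s1" "vector_space s2"
  shows "fscale c (\<Sum>(a, b)\<leftarrow>xs. tensor s1 s2 a b) = (\<Sum>(a, b)\<leftarrow>map (\<lambda>(a, b). (s1 c a, b)) xs. tensor s1 s2 a b)"
proof (induction xs)
  case Nil
  then show ?case by (simp add: fscale_def fun_eq_iff)
next
  case (Cons x xs)
  interpret F: vector_space "fscale :: 'a \<Rightarrow> (('b \<Rightarrow> 'c \<Rightarrow> 'a) \<Rightarrow> 'a) \<Rightarrow> _" by (rule vector_space_fscale)
  obtain a b where x: "x = (a, b)" by (cases x)
  have "fscale c (tensor s1 s2 a b) = tensor s1 s2 (s1 c a) b"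
    using bilinear_on_tensor[OF vs, of UNIV UNIV] by (auto simp: bilinear_on_def linear_map_on_def)
  then show ?case using Cons.IH
    by (simp only: x list.map sum_list.Cons prod.case F.scale_right_distrib)
qed

lemma tensor_space_iff:
  assumes vs: "vector_space s1" "vector_space s2"
    and sub: "module.subspace s1 A" "module.subspace s2 B"
  shows "t \<in> tensor_space s1 s2 A B \<longleftrightarrow> (\<exists>xs. set xs \<subseteq> A \<times> B \<and> t = (\<Sum>(a, b)\<leftarrow>xs. tensor s1 s2 a b))"
    (is "_ \<longleftrightarrow> ?R t")
proof
  interpret V1: vector_space s1 by fact
  interpret F: vector_space "fscale :: 'a \<Rightarrow> (('b \<Rightarrow> 'c \<Rightarrow> 'a) \<Rightarrow> 'a) \<Rightarrow> _" by (rule vector_space_fscale)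
  {
    assume "t \<in> tensor_space s1 s2 A B"
    then show "?R t" unfolding tensor_space_def
    proof (induction rule: F.span_induct_alt)
      case base
      show ?case by (intro exI[of _ "[]"]) auto
    next
      case (step c x y)
      then obtain a b xs where *: "x = tensor s1 s2 a b" "a \<in> A" "b \<in> B" "set xs \<subseteq> A \<times> B"
        "y = (\<Sum>(a, b)\<leftarrow>xs. tensor s1 s2 a b)" by auto
      have "fscale c x = tensor s1 s2 (s1 c a) b"
        using bilinear_on_tensor[OF vs, of UNIV UNIV] * by (auto simp: bilinear_on_def linear_map_on_def)
      moreover have "s1 c a \<in> A" using sub(1) * by (simp add: V1.subspace_scale)
      ultimately show ?case using * by (intro exI[of _ "(s1 c a, b) # xs"]) auto
    qed
  next
    assume "?R t"
    then obtain xs where "set xs \<subseteq> A \<times> B" "t = (\<Sum>(a, b)\<leftarrow>xs. tensor s1 s2 a b)" by blast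
    then show "t \<in> tensor_space s1 s2 A B"
    proof (induction xs arbitrary: t)
      case Nil
      then show ?case by (simp only: tensor_space_def F.span_zero list.map sum_list.Nil)
    next
      case (Cons x xs)
      obtain a b where x: "x = (a, b)" "a \<in> A" "b \<in> B" using Cons.prems by (cases x) auto
      have "t = tensor s1 s2 a b + (\<Sum>(a, b)\<leftarrow>xs. tensor s1 s2 a b)"
        using Cons.prems x by (simp only: list.map sum_list.Cons prod.case)
      moreover have "(\<Sum>(a, b)\<leftarrow>xs. tensor s1 s2 a b) \<in> tensor_space s1 s2 A B"
        using Cons by simp
      moreover have "tensor s1 s2 a b \<in> tensor_space s1 s2 A B"
        unfolding tensor_space_def using x by (intro F.span_base) blast
      ultimately show ?case unfolding tensor_space_def by (simp only: F.span_add)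
    qed
  }
qed

lemma tensor_lift_linear:
  assumes vs: "vector_space s1" "vector_space s2" "vector_space s3"
    and sub: "module.subspace s1 A" "module.subspace s2 B"
    and f: "bilinear_on s1 s2 s3 A B f"
  shows "linear_map_on fscale s3 (tensor_space s1 s2 A B) UNIV (tensor_lift s1 s2 A B f)"
proof -
  interpret V1: vector_space s1 by fact
  interpret V3: vector_space s3 by fact
  note eq = tensor_lift_eq[OF assms]
  note mem = tensor_space_iff[OF vs(1,2) sub]
  have "tensor_lift s1 s2 A B f (t + u) = tensor_lift s1 s2 A B f t + tensor_lift s1 s2 A B f u"
    if "t \<in> tensor_space s1 s2 A B" "u \<in> tensor_space s1 s2 A B" for t u
  proof -
    from that obtain xs ys where *: "set xs \<subseteq> A \<times> B" "t = (\<Sum>(a, b)\<leftarrow>xs. tensor s1 s2 a b)"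
      "set ys \<subseteq> A \<times> B" "u = (\<Sum>(a, b)\<leftarrow>ys. tensor s1 s2 a b)" unfolding mem by blast
    then show ?thesis using eq[of "xs @ ys"] eq[of xs] eq[of ys] by simp
  qed
  moreover have "tensor_lift s1 s2 A B f (fscale c t) = s3 c (tensor_lift s1 s2 A B f t)"
    if "t \<in> tensor_space s1 s2 A B" for c t
  proof -
    from that obtain xs where xs: "set xs \<subseteq> A \<times> B" and t: "t = (\<Sum>(a, b)\<leftarrow>xs. tensor s1 s2 a b)"
      unfolding mem by blast
    let ?ys = "map (\<lambda>(a, b). (s1 c a, b)) xs"
    have "set ?ys \<subseteq> A \<times> B" using xs sub(1) by (auto simp: V1.subspace_scale)
    then have "tensor_lift s1 s2 A B f (fscale c t) = (\<Sum>(a, b)\<leftarrow>?ys. f a b)"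
      unfolding t scale_sum_list_tensor[OF vs(1,2)] by (rule eq)
    also have "\<dots> = s3 c (\<Sum>(a, b)\<leftarrow>xs. f a b)"
      using xs f by (induction xs)
        (auto simp: V3.scale_right_distrib bilinear_on_def linear_map_on_def)
    finally show ?thesis using eq[OF xs] t by simp
  qed
  ultimately show ?thesis by (auto simp: linear_map_on_def)
qed

lemma tensor_unique:
  assumes vs: "vector_space s1" "vector_space s2"
    and sub: "module.subspace s1 A" "module.subspace s2 B"
    and g: "linear_map_on fscale s3 (tensor_space s1 s2 A B) UNIV g"
    and h: "linear_map_on fscale s3 (tensor_space s1 s2 A B) UNIV h"
    and gh: "\<And>a b. a \<in> A \<Longrightarrow> b \<in> B \<Longrightarrow> g (tensor s1 s2 a b) = h (tensor s1 s2 a b)"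
    and t: "t \<in> tensor_space s1 s2 A B"
  shows "g t = h t"
proof -
  obtain xs where xs: "set xs \<subseteq> A \<times> B" "t = (\<Sum>(a, b)\<leftarrow>xs. tensor s1 s2 a b)"
    using t tensor_space_iff[OF vs sub] by blast
  have gadd: "g (x + y) = g x + g y" and hadd: "h (x + y) = h x + h y"
    if "x \<in> tensor_space s1 s2 A B" "y \<in> tensor_space s1 s2 A B" for x y
    using g h that by (simp_all add: linear_map_on_def del: plus_fun_apply)
  from xs show ?thesis
  proof (induction xs arbitrary: t)
    case Nil
    have "0 \<in> tensor_space s1 s2 A B"
      unfolding tensor_space_iff[OF vs sub] by (intro exI[of _ "[]"]) auto
    then have "g 0 = 0" "h 0 = 0" using gadd[of 0 0] hadd[of 0 0] by simp_all
    moreover have "t = 0" using Nil.prems by (simp only: list.map sum_list.Nil)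
    ultimately show ?case by (simp only:)
  next
    case (Cons x xs)
    obtain a b where x: "x = (a, b)" "a \<in> A" "b \<in> B" using Cons.prems by (cases x) auto
    let ?u = "\<Sum>(a, b)\<leftarrow>xs. tensor s1 s2 a b"
    have m: "tensor s1 s2 a b \<in> tensor_space s1 s2 A B" "?u \<in> tensor_space s1 s2 A B"
      unfolding tensor_space_iff[OF vs sub] using Cons.prems x
      by (intro exI[of _ "[(a, b)]"] exI[of _ xs]; auto)+
    have "t = tensor s1 s2 a b + ?u"
      using Cons.prems x by (simp only: list.map sum_list.Cons prod.case)
    then have "g t = g (tensor s1 s2 a b) + g ?u" "h t = h (tensor s1 s2 a b) + h ?u"
      by (simp_all only: gadd[OF m] hadd[OF m])
    then show ?case using gh[OF x(2,3)] Cons.IH[of ?u] Cons.prems by simp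
  qed
qed

lemma subspace_tensor_space: "module.subspace fscale (tensor_space s1 s2 A B)"
proof -
  interpret F: vector_space "fscale :: 'a \<Rightarrow> (('b \<Rightarrow> 'c \<Rightarrow> 'a) \<Rightarrow> 'a) \<Rightarrow> _" by (rule vector_space_fscale)
  show ?thesis unfolding tensor_space_def by (rule F.subspace_span)
qed

lemma tensor_map_tensor:
  assumes vs: "vector_space s1" "vector_space s2" "vector_space t1" "vector_space t2"
    and sub: "module.subspace s1 A" "module.subspace s2 B"
    and f: "linear_map_on s1 t1 A X f" and g: "linear_map_on s2 t2 B Y g"
    and ab: "a \<in> A" "b \<in> B"
  shows "tensor_map s1 s2 t1 t2 A B f g (tensor s1 s2 a b) = tensor t1 t2 (f a) (g b)"
  unfolding tensor_map_def
proof (rule tensor_lift_tensor[OF vs(1,2) vector_space_fscale sub _ ab])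
  show "bilinear_on s1 s2 fscale A B (\<lambda>a b. tensor t1 t2 (f a) (g b))"
    using bilinear_on_tensor[OF vs(3,4), of UNIV UNIV] f g
    by (simp add: bilinear_on_def linear_map_on_def)
qed

lemma bilinear_on_tensor_assoc:
  assumes vs: "vector_space s" and sub: "module.subspace s D"
  shows "c \<in> D \<Longrightarrow> bilinear_on s s fscale D D (\<lambda>a b. tensor s fscale a (tensor s s b c))" (is "_ \<Longrightarrow> ?P c")
    and "bilinear_on fscale s fscale (tensor_space s s D D) D
      (\<lambda>t c. tensor_lift s s D D (\<lambda>a b. tensor s fscale a (tensor s s b c)) t)" (is ?Q)
proof -
  interpret F: vector_space "fscale :: 'a \<Rightarrow> (('b \<Rightarrow> (('b \<Rightarrow> 'b \<Rightarrow> 'a) \<Rightarrow> 'a) \<Rightarrow> 'a) \<Rightarrow> 'a) \<Rightarrow> _"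
    by (rule vector_space_fscale)
  interpret V: vector_space s by (rule vs)
  have P: "?P c" for c
    by (simp only: bilinear_on_def linear_map_on_def tensor_simps[OF vs vs]
        tensor_simps[OF vs vector_space_fscale]) simp
  then show "c \<in> D \<Longrightarrow> ?P c" .
  note lift = tensor_lift_eq[OF vs vs vector_space_fscale sub sub P]
  have "linear_map_on s fscale D UNIV
      (\<lambda>c. tensor_lift s s D D (\<lambda>a b. tensor s fscale a (tensor s s b c)) t)"
    if "t \<in> tensor_space s s D D" for t
  proof -
    from that have "\<exists>xs. set xs \<subseteq> D \<times> D \<and> t = (\<Sum>(a, b)\<leftarrow>xs. tensor s s a b)"
      by (simp only: tensor_space_iff[OF vs vs sub sub])
    then obtain xs where xs: "set xs \<subseteq> D \<times> D" and t: "t = (\<Sum>(a, b)\<leftarrow>xs. tensor s s a b)"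
      by (elim exE conjE) rule
    have "linear_map_on s fscale D UNIV (\<lambda>c. \<Sum>(a, b)\<leftarrow>xs. tensor s fscale a (tensor s s b c))"
    proof (induction xs)
      case Nil
      show ?case by (simp add: linear_map_on_def zero_fun_def fscale_def)
    next
      case (Cons x xs)
      then show ?case
        by (cases x) (simp add: linear_map_on_def F.scale_right_distrib tensor_simps[OF vs vs]
          tensor_simps[OF vs vector_space_fscale] del: plus_fun_apply)
    qed
    then show ?thesis unfolding t lift[OF xs] .
  qed
  then show ?Q
    using tensor_lift_linear[OF vs vs vector_space_fscale sub sub P] by (simp add: bilinear_on_def)
qed

lemma tensor_assoc_tensor:
  assumes vs: "vector_space s" and sub: "module.subspace s D"
    and "a \<in> D" "b \<in> D" "c \<in> D"
  shows "tensor_assoc s D (tensor fscale s (tensor s s a b) c) = tensor s fscale a (tensor s s b c)"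
proof -
  interpret F: vector_space "fscale :: 'a \<Rightarrow> (('b \<Rightarrow> 'b \<Rightarrow> 'a) \<Rightarrow> 'a) \<Rightarrow> _" by (rule vector_space_fscale)
  have "tensor s s a b \<in> tensor_space s s D D"
    unfolding tensor_space_def using assms by (intro F.span_base) blast
  then have "tensor_assoc s D (tensor fscale s (tensor s s a b) c) =
      tensor_lift s s D D (\<lambda>a b. tensor s fscale a (tensor s s b c)) (tensor s s a b)"
    unfolding tensor_assoc_def
    by (rule tensor_lift_tensor[OF vector_space_fscale vs vector_space_fscale subspace_tensor_space
          sub bilinear_on_tensor_assoc(2)[OF vs sub] _ assms(5)])
  also have "\<dots> = tensor s fscale a (tensor s s b c)"
    by (rule tensor_lift_tensor[OF vs vs vector_space_fscale sub sub
          bilinear_on_tensor_assoc(1)[OF vs sub assms(5)] assms(3,4)])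
  finally show ?thesis .
qed

end

theory Submission
  imports Defs
begin

text \<open>On \<open>C\<^sub>1\<close> the three comultiplications coincide with \<open>\<Delta>\<^sub>1\<close>, and on \<open>C\<^sub>2 = \<Phi> C\<^sub>1\<close> each of them sends
  \<open>\<Phi> y\<close> to \<open>p y\<^sub>1 \<otimes> q y\<^sub>2\<close> (Sweedler notation) with \<open>p, q \<in> {id, \<Phi>}\<close>. Hence both sides of every axiom,
  evaluated at \<open>\<Phi> y\<close>, have the form \<open>p y\<^sub>1 \<otimes> q y\<^sub>2 \<otimes> r y\<^sub>3\<close>; in each axiom the same \<open>p, q, r\<close> occur on both
  sides, so that it follows from the coassociativity of \<open>\<Delta>\<^sub>1\<close>.\<close>

section \<open>Linear maps between subspaces and their tensor products\<close>

lemma linear_map_on_comp: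
  assumes "linear_map_on s1 s2 A B f" "linear_map_on s2 s3 B C g"
  shows "linear_map_on s1 s3 A C (\<lambda>x. g (f x))"
  using assms by (auto simp: linear_map_on_def image_subset_iff)

lemma linear_map_on_weaken:
  assumes "linear_map_on s1 s2 A B f" "A' \<subseteq> A" "B \<subseteq> B'"
  shows "linear_map_on s1 s2 A' B' f"
  using assms unfolding linear_map_on_def by blast

lemma linear_map_on_id: "A \<subseteq> B \<Longrightarrow> linear_map_on s s A B id"
  by (auto simp: linear_map_on_def)

lemma linear_map_on_into: "linear_map_on s1 s2 A B f \<Longrightarrow> x \<in> A \<Longrightarrow> f x \<in> B"
  by (auto simp: linear_map_on_def)

lemma tensor_in_tensor_space: "a \<in> A \<Longrightarrow> b \<in> B \<Longrightarrow> tensor s1 s2 a b \<in> tensor_space s1 s2 A B"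
  unfolding tensor_space_def
  by (rule module.span_base[OF vector_space_fscale[folded module_iff_vector_space]]) blast

text \<open>Maps obtained from the universal property come with codomain \<open>UNIV\<close>, while
  composing them needs a sharper codomain. Elements of \<open>tensor_space s1 s2 A B\<close> are
  finite sums of elementary tensors, scalars being absorbed into the first factor, and the target is
  closed under sums.\<close>

lemma tensor_space_linear_into:
  assumes vs: "vector_space s1" "vector_space s2"
    and sub: "module.subspace s1 A" "module.subspace s2 B"
    and g: "linear_map_on fscale fscale (tensor_space s1 s2 A B) UNIV g"
    and gab: "\<And>a b. a \<in> A \<Longrightarrow> b \<in> B \<Longrightarrow> g (tensor s1 s2 a b) \<in> tensor_space t1 t2 X Y"
  shows "linear_map_on fscale fscale (tensor_space s1 s2 A B) (tensor_space t1 t2 X Y) g"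
proof -
  interpret F: vector_space "fscale :: 'a \<Rightarrow> (('d \<Rightarrow> 'e \<Rightarrow> 'a) \<Rightarrow> 'a) \<Rightarrow> _"
    by (rule vector_space_fscale)
  interpret G: vector_space "fscale :: 'a \<Rightarrow> (('b \<Rightarrow> 'c \<Rightarrow> 'a) \<Rightarrow> 'a) \<Rightarrow> _"
    by (rule vector_space_fscale)
  have gadd: "g (x + y) = g x + g y"
    if "x \<in> tensor_space s1 s2 A B" "y \<in> tensor_space s1 s2 A B" for x y
    using g that by (simp add: linear_map_on_def del: plus_fun_apply)
  note sp = subspace_tensor_space[of s1 s2 A B]
  have "g t \<in> tensor_space t1 t2 X Y" if "set xs \<subseteq> A \<times> B" "t = (\<Sum>(a, b)\<leftarrow>xs. tensor s1 s2 a b)" for xs t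
    using that
  proof (induction xs arbitrary: t)
    case Nil
    have z: "0 \<in> tensor_space s1 s2 A B" by (rule G.subspace_0[OF sp])
    have "g 0 = 0" using gadd[OF z z] by simp
    moreover have "t = 0" using Nil.prems by (simp only: list.map sum_list.Nil)
    ultimately show ?case using F.subspace_0[OF subspace_tensor_space] by (simp only:)
  next
    case (Cons x xs)
    obtain a b where x: "x = (a, b)" "a \<in> A" "b \<in> B" using Cons.prems by (cases x) auto
    let ?u = "\<Sum>(a, b)\<leftarrow>xs. tensor s1 s2 a b"
    have xs: "set xs \<subseteq> A \<times> B" using Cons.prems by simp
    have u: "?u \<in> tensor_space s1 s2 A B"
      unfolding tensor_space_iff[OF vs sub] using xs by blast
    have "t = tensor s1 s2 a b + ?u"
      using Cons.prems x by (simp only: list.map sum_list.Cons prod.case)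
    then have "g t = g (tensor s1 s2 a b) + g ?u"
      by (simp only: gadd[OF tensor_in_tensor_space[OF x(2,3)] u])
    then show ?case
      using F.subspace_add[OF subspace_tensor_space gab[OF x(2,3)] Cons.IH[OF xs refl]]
      by (simp only:)
  qed
  then have "g ` tensor_space s1 s2 A B \<subseteq> tensor_space t1 t2 X Y"
    unfolding image_subset_iff by (metis tensor_space_iff[OF vs sub])
  then show ?thesis using g unfolding linear_map_on_def by blast
qed

section \<open>Functoriality of the tensor product\<close>

lemma tensor_map_linear:
  assumes vs: "vector_space s1" "vector_space s2" "vector_space t1" "vector_space t2"
    and sub: "module.subspace s1 A" "module.subspace s2 B"
    and f: "linear_map_on s1 t1 A X f" and g: "linear_map_on s2 t2 B Y g"
  shows "linear_map_on fscale fscale (tensor_space s1 s2 A B) (tensor_space t1 t2 X Y)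
    (tensor_map s1 s2 t1 t2 A B f g)"
proof (rule tensor_space_linear_into[OF vs(1,2) sub])
  have "bilinear_on s1 s2 fscale A B (\<lambda>a b. tensor t1 t2 (f a) (g b))"
    using bilinear_on_tensor[OF vs(3,4), of UNIV UNIV] f g
    by (simp add: bilinear_on_def linear_map_on_def)
  then show "linear_map_on fscale fscale (tensor_space s1 s2 A B) UNIV (tensor_map s1 s2 t1 t2 A B f g)"
    unfolding tensor_map_def by (rule tensor_lift_linear[OF vs(1,2) vector_space_fscale sub])
  show "tensor_map s1 s2 t1 t2 A B f g (tensor s1 s2 a b) \<in> tensor_space t1 t2 X Y"
    if "a \<in> A" "b \<in> B" for a b
    unfolding tensor_map_tensor[OF assms that]
    by (rule tensor_in_tensor_space[OF linear_map_on_into[OF f that(1)] linear_map_on_into[OF g that(2)]])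
qed

lemma tensor_map_id:
  assumes vs: "vector_space s1" "vector_space s2"
    and sub: "module.subspace s1 A" "module.subspace s2 B"
    and t: "t \<in> tensor_space s1 s2 A B"
  shows "tensor_map s1 s2 s1 s2 A B id id t = t"
proof -
  \<comment> \<open>With \<open>id t\<close> on the right, both sides are linear maps applied to
    \<open>t\<close>, so that \<open>tensor_unique\<close> reduces the claim to elementary
    tensors.\<close>
  have "tensor_map s1 s2 s1 s2 A B id id t = id t"
  proof (rule tensor_unique[OF vs sub _ _ _ t])
    show "linear_map_on fscale fscale (tensor_space s1 s2 A B) UNIV (tensor_map s1 s2 s1 s2 A B id id)"
      by (rule linear_map_on_weaken[OF tensor_map_linear[OF vs vs sub linear_map_on_id linear_map_on_id]]) auto
    show "linear_map_on fscale fscale (tensor_space s1 s2 A B) UNIV id"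
      by (rule linear_map_on_id) simp
    show "tensor_map s1 s2 s1 s2 A B id id (tensor s1 s2 a b) = id (tensor s1 s2 a b)"
      if "a \<in> A" "b \<in> B" for a b
      using tensor_map_tensor[OF vs vs sub linear_map_on_id[OF subset_refl] linear_map_on_id[OF subset_refl] that]
      by (simp only: id_apply)
  qed
  then show ?thesis by (simp only: id_apply)
qed

text \<open>Both sides are linear and send \<open>a\<close> \<otimes> \<open>b\<close> to
  \<open>f' (f a)\<close> \<otimes> \<open>g' (g b)\<close>.\<close>

lemma tensor_map_comp:
  assumes vs: "vector_space s1" "vector_space s2" "vector_space t1" "vector_space t2"
      "vector_space u1" "vector_space u2"
    and sub: "module.subspace s1 A" "module.subspace s2 B" "module.subspace t1 X" "module.subspace t2 Y"
    and f: "linear_map_on s1 t1 A X f" and g: "linear_map_on s2 t2 B Y g"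
    and f': "linear_map_on t1 u1 X P f'" and g': "linear_map_on t2 u2 Y Q g'"
    and t: "t \<in> tensor_space s1 s2 A B"
  shows "tensor_map t1 t2 u1 u2 X Y f' g' (tensor_map s1 s2 t1 t2 A B f g t) =
    tensor_map s1 s2 u1 u2 A B (\<lambda>a. f' (f a)) (\<lambda>b. g' (g b)) t"
proof (rule tensor_unique[OF vs(1,2) sub(1,2) _ _ _ t])
  note l1 = tensor_map_linear[OF vs(1-4) sub(1,2) f g]
  note l2 = tensor_map_linear[OF vs(3-6) sub(3,4) f' g']
  note fc = linear_map_on_comp[OF f f'] and gc = linear_map_on_comp[OF g g']
  show "linear_map_on fscale fscale (tensor_space s1 s2 A B) UNIV
      (\<lambda>t. tensor_map t1 t2 u1 u2 X Y f' g' (tensor_map s1 s2 t1 t2 A B f g t))"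
    by (rule linear_map_on_weaken[OF linear_map_on_comp[OF l1 l2]]) auto
  show "linear_map_on fscale fscale (tensor_space s1 s2 A B) UNIV
      (tensor_map s1 s2 u1 u2 A B (\<lambda>a. f' (f a)) (\<lambda>b. g' (g b)))"
    by (rule linear_map_on_weaken[OF tensor_map_linear[OF vs(1,2,5,6) sub(1,2) fc gc]]) auto
  show "tensor_map t1 t2 u1 u2 X Y f' g' (tensor_map s1 s2 t1 t2 A B f g (tensor s1 s2 a b)) =
      tensor_map s1 s2 u1 u2 A B (\<lambda>a. f' (f a)) (\<lambda>b. g' (g b)) (tensor s1 s2 a b)"
    if ab: "a \<in> A" "b \<in> B" for a b
    unfolding tensor_map_tensor[OF vs(1-4) sub(1,2) f g ab]
      tensor_map_tensor[OF vs(1,2,5,6) sub(1,2) fc gc ab]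
    by (rule tensor_map_tensor[OF vs(3-6) sub(3,4) f' g'
          linear_map_on_into[OF f ab(1)] linear_map_on_into[OF g ab(2)]])
qed

lemma tensor_map_cong:
  assumes vs: "vector_space s1" "vector_space s2" "vector_space t1" "vector_space t2"
    and sub: "module.subspace s1 A" "module.subspace s2 B"
    and f: "linear_map_on s1 t1 A X f" and g: "linear_map_on s2 t2 B Y g"
    and ff: "\<And>a. a \<in> A \<Longrightarrow> f a = f' a" and gg: "\<And>b. b \<in> B \<Longrightarrow> g b = g' b"
    and t: "t \<in> tensor_space s1 s2 A B"
  shows "tensor_map s1 s2 t1 t2 A B f g t = tensor_map s1 s2 t1 t2 A B f' g' t"
proof (rule tensor_unique[OF vs(1,2) sub _ _ _ t])
  interpret V1: vector_space s1 by fact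
  interpret V2: vector_space s2 by fact
  \<comment> \<open>Linearity is assumed for \<open>f\<close> only. It passes to \<open>f'\<close>
    because the sums and multiples of elements of \<open>A\<close> stay in \<open>A\<close>, where
    the two maps agree.\<close>
  have f': "linear_map_on s1 t1 A X f'"
    using f ff unfolding linear_map_on_def image_subset_iff
    by (simp add: V1.subspace_add[OF sub(1)] V1.subspace_scale[OF sub(1)])
  have g': "linear_map_on s2 t2 B Y g'"
    using g gg unfolding linear_map_on_def image_subset_iff
    by (simp add: V2.subspace_add[OF sub(2)] V2.subspace_scale[OF sub(2)])
  show "linear_map_on fscale fscale (tensor_space s1 s2 A B) UNIV (tensor_map s1 s2 t1 t2 A B f g)"
    by (rule linear_map_on_weaken[OF tensor_map_linear[OF vs sub f g]]) auto
  show "linear_map_on fscale fscale (tensor_space s1 s2 A B) UNIV (tensor_map s1 s2 t1 t2 A B f' g')"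
    by (rule linear_map_on_weaken[OF tensor_map_linear[OF vs sub f' g']]) auto
  show "tensor_map s1 s2 t1 t2 A B f g (tensor s1 s2 a b) =
      tensor_map s1 s2 t1 t2 A B f' g' (tensor s1 s2 a b)" if "a \<in> A" "b \<in> B" for a b
    using ff gg that
    by (simp only: tensor_map_tensor[OF vs sub f g that] tensor_map_tensor[OF vs sub f' g' that])
qed

section \<open>The associator and its naturality\<close>

lemma tensor_assoc_linear:
  assumes vs: "vector_space s" and sub: "module.subspace s D"
  shows "linear_map_on fscale fscale (tensor_space fscale s (tensor_space s s D D) D) UNIV (tensor_assoc s D)"
  unfolding tensor_assoc_def
  by (rule tensor_lift_linear[OF vector_space_fscale vs vector_space_fscale subspace_tensor_space
        sub bilinear_on_tensor_assoc(2)[OF vs sub]])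

lemma tensor_linear_left:
  assumes "vector_space s1" "vector_space s2" "b \<in> B"
  shows "linear_map_on s1 fscale A (tensor_space s1 s2 A B) (\<lambda>a. tensor s1 s2 a b)"
  using tensor_simps[OF assms(1,2)] assms(3)
  by (auto simp: linear_map_on_def intro: tensor_in_tensor_space)

text \<open>For fixed \<open>c\<close> the value is linear in \<open>u\<close>, so it suffices to
  take \<open>u\<close> = \<open>a\<close> \<otimes> \<open>b\<close>, where the associator gives
  \<open>a\<close> \<otimes> (\<open>b\<close> \<otimes> \<open>c\<close>).\<close>

lemma tensor_assoc_in:
  assumes vs: "vector_space s" and sub: "module.subspace s D"
    and u: "u \<in> tensor_space s s D D" and c: "c \<in> D"
  shows "tensor_assoc s D (tensor fscale s u c) \<in> tensor_space s fscale D (tensor_space s s D D)"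
proof -
  have "linear_map_on fscale fscale (tensor_space s s D D) (tensor_space s fscale D (tensor_space s s D D))
     (\<lambda>u. tensor_assoc s D (tensor fscale s u c))"
  proof (rule tensor_space_linear_into[OF vs vs sub sub])
    show "linear_map_on fscale fscale (tensor_space s s D D) UNIV (\<lambda>u. tensor_assoc s D (tensor fscale s u c))"
      by (rule linear_map_on_comp[OF tensor_linear_left[OF vector_space_fscale vs c]
            tensor_assoc_linear[OF vs sub]])
    show "tensor_assoc s D (tensor fscale s (tensor s s a b) c) \<in> tensor_space s fscale D (tensor_space s s D D)"
      if "a \<in> D" "b \<in> D" for a b
      unfolding tensor_assoc_tensor[OF vs sub that c] using that c
      by (intro tensor_in_tensor_space)
  qed
  then show ?thesis using u by (rule linear_map_on_into)
qed

lemma tensor_assoc_linear_into: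
  assumes vs: "vector_space s" and sub: "module.subspace s D"
  shows "linear_map_on fscale fscale (tensor_space fscale s (tensor_space s s D D) D)
    (tensor_space s fscale D (tensor_space s s D D)) (tensor_assoc s D)"
  by (rule tensor_space_linear_into[OF vector_space_fscale vs subspace_tensor_space sub
        tensor_assoc_linear[OF vs sub] tensor_assoc_in[OF vs sub]])

text \<open>Both sides are linear and send (\<open>a\<close> \<otimes> \<open>b\<close>) \<otimes>
  \<open>c\<close> to \<open>p a\<close> \<otimes> (\<open>q b\<close> \<otimes>
  \<open>r c\<close>). Uniqueness is used twice: once for the outer tensor product and once for its
  first factor.\<close>

lemma tensor_assoc_natural:
  assumes vs: "vector_space s" and C: "module.subspace s C" and D: "module.subspace s D"
    and p: "linear_map_on s s C D p" and q: "linear_map_on s s C D q" and r: "linear_map_on s s C D r"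
    and t: "t \<in> tensor_space fscale s (tensor_space s s C C) C"
  shows "tensor_assoc s D
      (tensor_map fscale s fscale s (tensor_space s s C C) C (tensor_map s s s s C C p q) r t) =
    tensor_map s fscale s fscale C (tensor_space s s C C) p (tensor_map s s s s C C q r) (tensor_assoc s C t)"
proof -
  let ?L = "\<lambda>t. tensor_assoc s D
      (tensor_map fscale s fscale s (tensor_space s s C C) C (tensor_map s s s s C C p q) r t)"
    and ?R = "\<lambda>t. tensor_map s fscale s fscale C (tensor_space s s C C) p (tensor_map s s s s C C q r)
      (tensor_assoc s C t)"
  note vf = vector_space_fscale and st = subspace_tensor_space
  note pq = tensor_map_linear[OF vs vs vs vs C C p q] and qr = tensor_map_linear[OF vs vs vs vs C C q r]
  note pqr = tensor_map_linear[OF vf vs vf vs st C pq r]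
    and pqr' = tensor_map_linear[OF vs vf vs vf C st p qr]
  have L: "linear_map_on fscale fscale (tensor_space fscale s (tensor_space s s C C) C) UNIV ?L"
    by (rule linear_map_on_comp[OF pqr tensor_assoc_linear[OF vs D]])
  have R: "linear_map_on fscale fscale (tensor_space fscale s (tensor_space s s C C) C) UNIV ?R"
    by (rule linear_map_on_comp[OF tensor_assoc_linear_into[OF vs C]
          linear_map_on_weaken[OF pqr' subset_refl subset_UNIV]])
  show ?thesis
  proof (rule tensor_unique[OF vf vs st C L R _ t])
    fix u c assume u: "u \<in> tensor_space s s C C" and c: "c \<in> C"
    \<comment> \<open>With \<open>c\<close> fixed, \<open>u\<close> is still an arbitrary element of
      the inner tensor product. Composing \<open>?L\<close> and \<open>?R\<close> with the linear
      map \<open>u\<close> \<mapsto> \<open>u\<close> \<otimes> \<open>c\<close> allows the second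
      use of uniqueness.\<close>
    note lin = tensor_linear_left[OF vf vs c]
    show "?L (tensor fscale s u c) = ?R (tensor fscale s u c)"
    proof (rule tensor_unique[OF vs vs C C linear_map_on_comp[OF lin L] linear_map_on_comp[OF lin R] _ u])
      fix a b assume a: "a \<in> C" and b: "b \<in> C"
      note pa = linear_map_on_into[OF p a] and qb = linear_map_on_into[OF q b]
        and rc = linear_map_on_into[OF r c]
      show "?L (tensor fscale s (tensor s s a b) c) = ?R (tensor fscale s (tensor s s a b) c)"
        by (simp only: tensor_assoc_tensor[OF vs C a b c] tensor_assoc_tensor[OF vs D pa qb rc]
            tensor_map_tensor[OF vf vs vf vs st C pq r tensor_in_tensor_space[OF a b] c]
            tensor_map_tensor[OF vs vf vs vf C st p qr a tensor_in_tensor_space[OF b c]]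
            tensor_map_tensor[OF vs vs vs vs C C p q a b]
            tensor_map_tensor[OF vs vs vs vs C C q r b c])
    qed
  qed
qed

section \<open>Twisted comultiplications and coassociativity\<close>

lemma tensor_id_right_linear:
  assumes vs: "vector_space s" and D: "module.subspace s D"
    and f: "linear_map_on s fscale D (tensor_space s s D D) f"
  shows "linear_map_on fscale fscale (tensor_space s s D D) UNIV (tensor_id_right s D f)"
  unfolding tensor_id_right_def
  by (rule linear_map_on_comp[OF tensor_map_linear[OF vs vs vector_space_fscale vs D D f
          linear_map_on_id[OF subset_refl]] tensor_assoc_linear[OF vs D]])

lemma tensor_id_left_linear:
  assumes vs: "vector_space s" and D: "module.subspace s D"
    and f: "linear_map_on s fscale D (tensor_space s s D D) f"
  shows "linear_map_on fscale fscale (tensor_space s s D D) UNIV (tensor_id_left s D f)"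
  unfolding tensor_id_left_def
  by (rule linear_map_on_weaken[OF tensor_map_linear[OF vs vs vs vector_space_fscale D D
          linear_map_on_id[OF subset_refl] f]]) auto

text \<open>By functoriality and \<open>fa\<close>, (\<open>f\<close> \<otimes> id)(\<open>a\<close>
  \<otimes> \<open>r\<close>) = ((\<open>p\<close> \<otimes> \<open>q\<close>) \<otimes>
  \<open>r\<close>)(\<Delta> \<otimes> id); naturality of the associator then moves the three twists
  outside.\<close>

lemma tensor_id_right_tensor_map:
  assumes vs: "vector_space s" and C: "module.subspace s C" and D: "module.subspace s D"
    and \<Delta>: "linear_map_on s fscale C (tensor_space s s C C) \<Delta>"
    and f: "linear_map_on s fscale D (tensor_space s s D D) f"
    and a: "linear_map_on s s C D a" and p: "linear_map_on s s C D p"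
    and q: "linear_map_on s s C D q" and r: "linear_map_on s s C D r"
    and fa: "\<And>y. y \<in> C \<Longrightarrow> f (a y) = tensor_map s s s s C C p q (\<Delta> y)"
    and t: "t \<in> tensor_space s s C C"
  shows "tensor_id_right s D f (tensor_map s s s s C C a r t) =
    tensor_map s fscale s fscale C (tensor_space s s C C) p (tensor_map s s s s C C q r)
      (tensor_id_right s C \<Delta> t)"
proof -
  note vf = vector_space_fscale and st = subspace_tensor_space
  note pq = tensor_map_linear[OF vs vs vs vs C C p q]
  note idC = linear_map_on_id[OF subset_refl[of C], of s] and idD = linear_map_on_id[OF subset_refl[of D], of s]
  note dl = tensor_map_linear[OF vs vs vf vs C C \<Delta> idC]
  have "tensor_map s s fscale s D D f id (tensor_map s s s s C C a r t) =
      tensor_map s s fscale s C C (\<lambda>y. f (a y)) (\<lambda>y. id (r y)) t"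
    by (rule tensor_map_comp[OF vs vs vs vs vf vs C C D D a r f idD t])
  \<comment> \<open>Besides \<open>fa\<close>, this rewrites \<open>id (r y)\<close> as
    \<open>r (id y)\<close>: the identity on \<open>D\<close> becomes one on \<open>C\<close>, so
    that \<Delta> \<otimes> id can be split off as the inner map.\<close>
  also have "\<dots> = tensor_map s s fscale s C C (\<lambda>y. tensor_map s s s s C C p q (\<Delta> y)) (\<lambda>y. r (id y)) t"
    by (rule tensor_map_cong[OF vs vs vf vs C C linear_map_on_comp[OF a f] linear_map_on_comp[OF r idD] _ _ t])
      (simp_all only: fa id_apply)
  also have "\<dots> = tensor_map fscale s fscale s (tensor_space s s C C) C (tensor_map s s s s C C p q) r
      (tensor_map s s fscale s C C \<Delta> id t)"
    by (rule tensor_map_comp[OF vs vs vf vs vf vs C C st C \<Delta> idC pq r t, symmetric])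
  finally show ?thesis
    unfolding tensor_id_right_def
    by (simp only: tensor_assoc_natural[OF vs C D p q r linear_map_on_into[OF dl t]])
qed

text \<open>The mirror image of \<open>tensor_id_right_tensor_map\<close>. Here id \<otimes>
  \<open>f\<close> already lands in the right-bracketed product, so functoriality alone moves the
  twists outside.\<close>

lemma tensor_id_left_tensor_map:
  assumes vs: "vector_space s" and C: "module.subspace s C" and D: "module.subspace s D"
    and \<Delta>: "linear_map_on s fscale C (tensor_space s s C C) \<Delta>"
    and f: "linear_map_on s fscale D (tensor_space s s D D) f"
    and a: "linear_map_on s s C D a" and p: "linear_map_on s s C D p"
    and q: "linear_map_on s s C D q" and r: "linear_map_on s s C D r"
    and fa: "\<And>y. y \<in> C \<Longrightarrow> f (a y) = tensor_map s s s s C C q r (\<Delta> y)"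
    and t: "t \<in> tensor_space s s C C"
  shows "tensor_id_left s D f (tensor_map s s s s C C p a t) =
    tensor_map s fscale s fscale C (tensor_space s s C C) p (tensor_map s s s s C C q r)
      (tensor_id_left s C \<Delta> t)"
proof -
  note vf = vector_space_fscale and st = subspace_tensor_space
  note qr = tensor_map_linear[OF vs vs vs vs C C q r]
  note idC = linear_map_on_id[OF subset_refl[of C], of s] and idD = linear_map_on_id[OF subset_refl[of D], of s]
  have "tensor_map s s s fscale D D id f (tensor_map s s s s C C p a t) =
      tensor_map s s s fscale C C (\<lambda>y. id (p y)) (\<lambda>y. f (a y)) t"
    by (rule tensor_map_comp[OF vs vs vs vs vs vf C C D D p a idD f t])
  also have "\<dots> = tensor_map s s s fscale C C (\<lambda>y. p (id y)) (\<lambda>y. tensor_map s s s s C C q r (\<Delta> y)) t"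
    by (rule tensor_map_cong[OF vs vs vs vf C C linear_map_on_comp[OF p idD] linear_map_on_comp[OF a f] _ _ t])
      (simp_all only: fa id_apply)
  also have "\<dots> = tensor_map s fscale s fscale C (tensor_space s s C C) p (tensor_map s s s s C C q r)
      (tensor_map s s s fscale C C id \<Delta> t)"
    by (rule tensor_map_comp[OF vs vs vs vf vs vf C C C st idC \<Delta> p qr t, symmetric])
  finally show ?thesis unfolding tensor_id_left_def .
qed

text \<open>A common form for all that is known about the comultiplications: \<open>a\<close> = id
  describes \<open>f\<close> on \<open>C\<close> itself, and \<open>a\<close> = \<Phi> describes it
  on the image of \<Phi>.\<close>

definition twisted_comult where
  "twisted_comult s C \<Delta> f a p q \<longleftrightarrow> (\<forall>y\<in>C. f (a y) = tensor_map s s s s C C p q (\<Delta> y))"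

lemma twisted_comult_id:
  assumes vs: "vector_space s" and C: "module.subspace s C"
    and \<Delta>: "linear_map_on s fscale C (tensor_space s s C C) \<Delta>"
    and f: "\<And>y. y \<in> C \<Longrightarrow> f y = \<Delta> y"
  shows "twisted_comult s C \<Delta> f id id id"
  unfolding twisted_comult_def
proof
  fix y assume y: "y \<in> C"
  show "f (id y) = tensor_map s s s s C C id id (\<Delta> y)"
    unfolding tensor_map_id[OF vs vs C C linear_map_on_into[OF \<Delta> y]] using f[OF y] by (simp only: id_apply)
qed

text \<open>Both sides equal \<open>p y\<^sub>1 \<otimes> q y\<^sub>2 \<otimes> r y\<^sub>3\<close>.\<close>

lemma coassociative_twisted:
  assumes vs: "vector_space s" and C: "module.subspace s C" and D: "module.subspace s D"
    and \<Delta>: "linear_map_on s fscale C (tensor_space s s C C) \<Delta>" and co: "coassociative s C \<Delta>"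
    and g: "linear_map_on s fscale D (tensor_space s s D D) g"
    and h: "linear_map_on s fscale D (tensor_space s s D D) h"
    and maps: "linear_map_on s s C D b" "linear_map_on s s C D c" "linear_map_on s s C D p"
      "linear_map_on s s C D q" "linear_map_on s s C D r"
    and f: "twisted_comult s C \<Delta> f a b r" and gb: "twisted_comult s C \<Delta> g b p q"
    and f': "twisted_comult s C \<Delta> f' a p c" and hc: "twisted_comult s C \<Delta> h c q r"
    and y: "y \<in> C"
  shows "tensor_id_right s D g (f (a y)) = tensor_id_left s D h (f' (a y))"
proof -
  note t = linear_map_on_into[OF \<Delta> y]
  \<comment> \<open>The map \<open>f\<close> leaves the twist \<open>b\<close> on its first leg, and
    \<open>g\<close> replaces \<open>b\<close> by \<open>p\<close>, \<open>q\<close>;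
    \<open>f'\<close> leaves \<open>c\<close> on its second leg, and \<open>h\<close> replaces
    \<open>c\<close> by \<open>q\<close>, \<open>r\<close>. Both sides thus carry the same outer
    map.\<close>
  have 1: "f (a y) = tensor_map s s s s C C b r (\<Delta> y)" "f' (a y) = tensor_map s s s s C C p c (\<Delta> y)"
    using f f' y unfolding twisted_comult_def by blast+
  have 2: "g (b z) = tensor_map s s s s C C p q (\<Delta> z)" if "z \<in> C" for z
    using gb that unfolding twisted_comult_def by blast
  have 3: "h (c z) = tensor_map s s s s C C q r (\<Delta> z)" if "z \<in> C" for z
    using hc that unfolding twisted_comult_def by blast
  have "tensor_id_right s C \<Delta> (\<Delta> y) = tensor_id_left s C \<Delta> (\<Delta> y)"
    using co y unfolding coassociative_def by blast
  then show ?thesis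
    by (simp only: 1 tensor_id_right_tensor_map[OF vs C D \<Delta> g maps(1,3,4,5) 2 t]
        tensor_id_left_tensor_map[OF vs C D \<Delta> h maps(2,3,4,5) 3 t])
qed

text \<open>Each axiom compares two linear maps on \<open>C1 + C2\<close>, so this reduces it to the
  two summands.\<close>

lemma linear_map_on_eq_on_sum:
  assumes vs: "vector_space s"
    and sub: "module.subspace s A" "module.subspace s B"
    and f: "linear_map_on s s' (A + B) X f" and g: "linear_map_on s s' (A + B) Y g"
    and A: "\<And>x. x \<in> A \<Longrightarrow> f x = g x" and B: "\<And>x. x \<in> B \<Longrightarrow> f x = g x"
    and x: "x \<in> A + B"
  shows "f x = g x"
proof -
  interpret vector_space s by fact
  from x obtain a b where ab: "a \<in> A" "b \<in> B" "x = a + b" by (auto elim: set_plus_elim)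
  \<comment> \<open>Additivity of \<open>f\<close> and \<open>g\<close> is available only inside
    \<open>A + B\<close>, so both components must be placed there, as \<open>a + 0\<close> and
    \<open>0 + b\<close>.\<close>
  have "a \<in> A + B" "b \<in> A + B"
    using ab set_plus_intro[OF ab(1) subspace_0[OF sub(2)]] set_plus_intro[OF subspace_0[OF sub(1)] ab(2)]
    by simp_all
  with f g A[OF ab(1)] B[OF ab(2)] show ?thesis unfolding linear_map_on_def ab(3) by metis
qed

section \<open>The codialgebra and cotrialgebra axioms\<close>

theorem theorem2p14:
  fixes scale :: "'k::field \<Rightarrow> 'v::ab_group_add \<Rightarrow> 'v"
    and C1 C2 D :: "'v set"
    and \<Delta>1 \<Delta>2 \<Delta>s \<delta>1 \<delta>h1 :: "'v \<Rightarrow> (('v \<Rightarrow> 'v \<Rightarrow> 'k) \<Rightarrow> 'k)"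
    and \<epsilon>1 \<epsilon>2 :: "'v \<Rightarrow> 'k"
    and \<Phi> :: "'v \<Rightarrow> 'v"
  assumes "real_or_complex_field TYPE('k)"
    and "vector_space scale"
    and "countable_dimension scale"
    and "D = C1 + C2"
    and "counital_coalgebra scale C1 \<Delta>1 \<epsilon>1"
    and "counital_coalgebra scale C2 \<Delta>2 \<epsilon>2"
    and "channel_map scale C1 \<Delta>1 \<epsilon>1 C2 \<Delta>2 \<epsilon>2 \<Phi>"
    and "linear_map_on scale fscale D (tensor_space scale scale D D) \<Delta>s"
    and "linear_map_on scale fscale D (tensor_space scale scale D D) \<delta>1"
    and "linear_map_on scale fscale D (tensor_space scale scale D D) \<delta>h1"
    and "\<forall>x\<in>C1. \<Delta>s x = \<Delta>1 x"
    and "\<forall>x\<in>C2. \<Delta>s x = \<Delta>2 x"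
    and "\<forall>x\<in>C1. \<delta>1 x = \<Delta>1 x"
    and "\<forall>x\<in>C1. \<delta>1 (\<Phi> x) = tensor_map scale scale scale scale C1 C1 id \<Phi> (\<Delta>1 x)"
    and "\<forall>x\<in>C1. \<delta>h1 x = \<Delta>1 x"
    and "\<forall>x\<in>C1. \<delta>h1 (\<Phi> x) = tensor_map scale scale scale scale C1 C1 \<Phi> id (\<Delta>1 x)"
  shows "coassociative_codialgebra scale D \<delta>1 \<delta>h1 \<and> coassociative_cotrialgebra scale D \<Delta>s \<delta>1 \<delta>h1"
proof -
  note vs = assms(2)
  interpret vector_space scale by (rule vs)
  have C1: "subspace C1" and C2: "subspace C2"
    and \<Delta>1: "linear_map_on scale fscale C1 (tensor_space scale scale C1 C1) \<Delta>1"
    and co1: "coassociative scale C1 \<Delta>1"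
    using assms(5,6) by (simp_all only: counital_coalgebra_def)
  have \<Phi>: "linear_map_on scale scale C1 C2 \<Phi>" and \<Phi>_onto: "\<Phi> ` C1 = C2"
    and \<Delta>2: "\<forall>x\<in>C1. \<Delta>2 (\<Phi> x) = tensor_map scale scale scale scale C1 C1 \<Phi> \<Phi> (\<Delta>1 x)"
    using assms(7) unfolding channel_map_def bij_betw_def by blast+
  note D_eq = assms(4)
  have D: "subspace D"
    unfolding D_eq using subspace_sums[OF C1 C2] by (simp add: set_plus_def Bex_def conj_ac)
  have "C1 \<subseteq> D" "C2 \<subseteq> D"
    unfolding D_eq
    using set_plus_intro[OF _ subspace_0[OF C2], of _ C1] set_plus_intro[OF subspace_0[OF C1], of _ C2]
    by (simp_all add: subset_iff)
  then have idD: "linear_map_on scale scale C1 D id" and \<Phi>D: "linear_map_on scale scale C1 D \<Phi>"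
    by (auto intro: linear_map_on_id linear_map_on_weaken[OF \<Phi>])
  note \<Delta>s = assms(8) and \<delta> = assms(9) and \<delta>h = assms(10)
  have on_C1: "twisted_comult scale C1 \<Delta>1 \<Delta>s id id id" "twisted_comult scale C1 \<Delta>1 \<delta>1 id id id"
    "twisted_comult scale C1 \<Delta>1 \<delta>h1 id id id"
    using assms(11,13,15) by (simp_all add: twisted_comult_id[OF vs C1 \<Delta>1])
  \<comment> \<open>For \<open>\<Delta>s\<close> the twists on \<open>C2\<close> come from the
    channel map being a coalgebra morphism; for the other two they are prescribed.\<close>
  have on_C2: "twisted_comult scale C1 \<Delta>1 \<Delta>s \<Phi> \<Phi> \<Phi>" "twisted_comult scale C1 \<Delta>1 \<delta>1 \<Phi> id \<Phi>"
    "twisted_comult scale C1 \<Delta>1 \<delta>h1 \<Phi> \<Phi> id"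
    using assms(12,14,16) \<Delta>2 linear_map_on_into[OF \<Phi>] by (simp_all add: twisted_comult_def)
  \<comment> \<open>The scheme for all axioms. On \<open>C1\<close> every twist is id; on
    \<open>C2\<close> the final twists are \<open>p\<close>, \<open>q\<close>, \<open>r\<close>,
    while \<open>b\<close> and \<open>c\<close> are the twists on the leg that \<open>g\<close>,
    respectively \<open>h\<close>, is about to expand.\<close>
  have key: "tensor_id_right scale D g (f x) = tensor_id_left scale D h (f' x)"
    if x: "x \<in> D"
      and lin: "linear_map_on scale fscale D (tensor_space scale scale D D) f"
        "linear_map_on scale fscale D (tensor_space scale scale D D) f'"
        "linear_map_on scale fscale D (tensor_space scale scale D D) g"
        "linear_map_on scale fscale D (tensor_space scale scale D D) h"
      and 1: "twisted_comult scale C1 \<Delta>1 f id id id" "twisted_comult scale C1 \<Delta>1 f' id id id"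
        "twisted_comult scale C1 \<Delta>1 g id id id" "twisted_comult scale C1 \<Delta>1 h id id id"
      and maps: "linear_map_on scale scale C1 D b" "linear_map_on scale scale C1 D c"
        "linear_map_on scale scale C1 D p" "linear_map_on scale scale C1 D q"
        "linear_map_on scale scale C1 D r"
      and 2: "twisted_comult scale C1 \<Delta>1 f \<Phi> b r" "twisted_comult scale C1 \<Delta>1 g b p q"
        "twisted_comult scale C1 \<Delta>1 f' \<Phi> p c" "twisted_comult scale C1 \<Delta>1 h c q r"
    for f f' g h b c p q r x
  proof (rule linear_map_on_eq_on_sum[OF vs C1 C2 _ _ _ _ x[unfolded D_eq]])
    show "linear_map_on scale fscale (C1 + C2) UNIV (\<lambda>x. tensor_id_right scale D g (f x))"
      using linear_map_on_comp[OF lin(1) tensor_id_right_linear[OF vs D lin(3)]] unfolding D_eq .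
    show "linear_map_on scale fscale (C1 + C2) UNIV (\<lambda>x. tensor_id_left scale D h (f' x))"
      using linear_map_on_comp[OF lin(2) tensor_id_left_linear[OF vs D lin(4)]] unfolding D_eq .
    show "tensor_id_right scale D g (f x) = tensor_id_left scale D h (f' x)" if "x \<in> C1" for x
      using coassociative_twisted[OF vs C1 D \<Delta>1 co1 lin(3,4) idD idD idD idD idD 1(1,3,2,4) that]
      by (simp only: id_apply)
    show "tensor_id_right scale D g (f x) = tensor_id_left scale D h (f' x)" if x: "x \<in> C2" for x
    proof -
      obtain y where "y \<in> C1" "x = \<Phi> y" using x \<Phi>_onto by blast
      then show ?thesis
        using coassociative_twisted[OF vs C1 D \<Delta>1 co1 lin(3,4) maps 2] by (simp only:)
    qed
  qed
  \<comment> \<open>The maps after the first \<open>on_C1\<close> block are \<open>b\<close>,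
    \<open>c\<close>, \<open>p\<close>, \<open>q\<close>, \<open>r\<close>. Where \<open>b\<close>
    or \<open>c\<close> is id, the leg to be expanded lies in \<open>C1\<close>, on which the three
    comultiplications coincide; \<open>on_C1\<close> then supplies the condition.\<close>
  note \<Delta>_\<Delta> = key[OF _ \<Delta>s \<Delta>s \<Delta>s \<Delta>s on_C1(1,1,1,1) \<Phi>D \<Phi>D \<Phi>D \<Phi>D \<Phi>D on_C2(1,1,1,1)]
  note \<delta>_\<delta> = key[OF _ \<delta> \<delta> \<delta> \<delta> on_C1(2,2,2,2) idD \<Phi>D idD idD \<Phi>D on_C2(2) on_C1(2) on_C2(2,2)]
  note \<delta>h_\<delta> = key[OF _ \<delta> \<delta> \<delta>h \<delta> on_C1(2,2,3,2) idD \<Phi>D idD idD \<Phi>D on_C2(2) on_C1(3) on_C2(2,2)]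
  note \<delta>h_\<delta>h = key[OF _ \<delta>h \<delta>h \<delta>h \<delta>h on_C1(3,3,3,3) \<Phi>D idD \<Phi>D idD idD on_C2(3,3,3) on_C1(3)]
  note \<delta>h_\<delta>h' = key[OF _ \<delta>h \<delta>h \<delta>h \<delta> on_C1(3,3,3,2) \<Phi>D idD \<Phi>D idD idD on_C2(3,3,3) on_C1(2)]
  note \<delta>_\<delta>h = key[OF _ \<delta>h \<delta> \<delta> \<delta>h on_C1(3,2,2,3) \<Phi>D \<Phi>D idD \<Phi>D idD on_C2(3,2,2,3)]
  have codi: "coassociative_codialgebra scale D \<delta>1 \<delta>h1"
    unfolding coassociative_codialgebra_def coassociative_def
    \<comment> \<open>Two axioms have the same kind of extension on both sides and are no instances
      of \<open>key\<close>. They follow from two instances with a common side: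
      (\<open>\<delta>h1\<close> \<otimes> id)\<open>\<delta>h1\<close> for the first, (id \<otimes>
      \<open>\<delta>1\<close>)\<open>\<delta>1\<close> for the second.\<close>
    by (intro conjI ballI D \<delta> \<delta>h \<delta>_\<delta> \<delta>h_\<delta>h \<delta>_\<delta>h trans[OF \<delta>h_\<delta>h[symmetric] \<delta>h_\<delta>h']
        trans[OF \<delta>_\<delta> \<delta>h_\<delta>[symmetric]])
  \<comment> \<open>The triples (\<open>p\<close>, \<open>q\<close>, \<open>r\<close>) are now
    (\<Phi>, id, id), (\<Phi>, \<Phi>, id), (\<Phi>, id, \<Phi>), (id, \<Phi>, \<Phi>) and (id, id,
    \<Phi>). With (\<Phi>, \<Phi>, \<Phi>) and (id, \<Phi>, id) from above, every triple other than
    (id, id, id) occurs.\<close>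
  note \<delta>h_\<Delta> = key[OF _ \<delta>h \<delta>h \<delta>h \<Delta>s on_C1(3,3,3,1) \<Phi>D idD \<Phi>D idD idD on_C2(3,3,3) on_C1(1)]
  note \<Delta>_\<delta>h = key[OF _ \<delta>h \<Delta>s \<Delta>s \<delta>h on_C1(3,1,1,3) \<Phi>D \<Phi>D \<Phi>D \<Phi>D idD on_C2(3,1,1,3)]
  note \<delta>h_\<delta>_\<Delta> = key[OF _ \<Delta>s \<Delta>s \<delta>h \<delta> on_C1(1,1,3,2) \<Phi>D \<Phi>D \<Phi>D idD \<Phi>D on_C2(1,3,1,2)]
  note \<delta>_\<Delta> = key[OF _ \<Delta>s \<delta> \<delta> \<Delta>s on_C1(1,2,2,1) \<Phi>D \<Phi>D idD \<Phi>D \<Phi>D on_C2(1,2,2,1)]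
  note \<Delta>_\<delta> = key[OF _ \<delta> \<delta> \<Delta>s \<delta> on_C1(2,2,1,2) idD \<Phi>D idD idD \<Phi>D on_C2(2) on_C1(1) on_C2(2,2)]
  have "coassociative_cotrialgebra scale D \<Delta>s \<delta>1 \<delta>h1"
    unfolding coassociative_cotrialgebra_def coassociative_def[of scale D \<Delta>s]
    by (intro conjI ballI \<Delta>s codi \<Delta>_\<Delta> \<delta>h_\<Delta> \<Delta>_\<delta>h \<delta>h_\<delta>_\<Delta> \<delta>_\<Delta> \<Delta>_\<delta>)
  with codi show ?thesis by blast
qed

end
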